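(* Let $A$ be a quandle, $R$ a congruence on $A$, and $N$ a normal subgroup of $\mathrm{Inn}(A)$. Then the congruences $R$ and $\sim_N$ permute: $\sim_N \circ R = R \circ \sim_N$.
   Context: A quandle is a set $A$ with two binary operations $\lhd,\lhd^{-1}$ such that for all $a,b,c\in A$: (A1) $a\lhd a=a=a\lhd^{-1}a$; (A2) $(a\lhd b)\lhd^{-1}b=a=(a\lhd^{-1}b)\lhd b$; (A3) $(a\lhd b)\lhd c=(a\lhd c)\lhd(b\lhd c)$ and $(a\lhd^{-1}b)\lhd^{-1}c=(a\lhd^{-1}c)\lhd^{-1}(b\lhd^{-1}c)$. For $b\in A$, the map $\rho_b\colon A\to A$, $\rho_b(a)=a\lhd b$, is an automorphism of $A$ (bijection preserving both operations). $\mathrm{Inn}(A)$ is the subgroup of the automorphism group of $A$ generated by all $\rho_b$, $b\in A$; it acts on $A$ by evaluation. A congruence on $A$ is an equivalence relation $R\subset A\times A$ that is a subquandle of the product quandle $A\times A$ (closed under the componentwise operations $\lhd$ and $\lhd^{-1}$). For a subgroup $N$ of $\mathrm{Inn}(A)$, $a\sim_N b$ means that $a$ and $b$ lie in the same orbit under the action of $N$ on $A$; when $N$ is normal in $\mathrm{Inn}(A)$ this is a congruence. The composite of two relations $R,S$ on $A$ is $S\circ R=\{(a,b)\in A\times A \mid \exists c\in A \text{ with } (a,c)\in R \text{ and } (c,b)\in S\}$. *)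

theory Defs
  imports "HOL-Algebra.Group_Action" "HOL-Algebra.Generated_Groups"
begin

record 'a quandle = "'a partial_object" +
  rtri :: "'a \<Rightarrow> 'a \<Rightarrow> 'a" (infixl \<open>\<triangleleft>\<index>\<close> 70)
  rtri_inv :: "'a \<Rightarrow> 'a \<Rightarrow> 'a" (infixl \<open>\<triangleleft>\<inverse>\<index>\<close> 70)

locale quandle =
  fixes A :: "('a, 'b) quandle_scheme" (structure)
  assumes rtri_closed:
      "\<lbrakk>a \<in> carrier A; b \<in> carrier A\<rbrakk> \<Longrightarrow> a \<triangleleft> b \<in> carrier A"
    and rtri_inv_closed:
      "\<lbrakk>a \<in> carrier A; b \<in> carrier A\<rbrakk> \<Longrightarrow> a \<triangleleft>\<inverse> b \<in> carrier A"
    and rtri_idem: "a \<in> carrier A \<Longrightarrow> a \<triangleleft> a = a"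
    and rtri_inv_idem: "a \<in> carrier A \<Longrightarrow> a \<triangleleft>\<inverse> a = a"
    and rtri_cancel:
      "\<lbrakk>a \<in> carrier A; b \<in> carrier A\<rbrakk> \<Longrightarrow> (a \<triangleleft> b) \<triangleleft>\<inverse> b = a"
    and rtri_inv_cancel:
      "\<lbrakk>a \<in> carrier A; b \<in> carrier A\<rbrakk> \<Longrightarrow> (a \<triangleleft>\<inverse> b) \<triangleleft> b = a"
    and rtri_distrib:
      "\<lbrakk>a \<in> carrier A; b \<in> carrier A; c \<in> carrier A\<rbrakk>
        \<Longrightarrow> (a \<triangleleft> b) \<triangleleft> c = (a \<triangleleft> c) \<triangleleft> (b \<triangleleft> c)"
    and rtri_inv_distrib:
      "\<lbrakk>a \<in> carrier A; b \<in> carrier A; c \<in> carrier A\<rbrakk>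
        \<Longrightarrow> (a \<triangleleft>\<inverse> b) \<triangleleft>\<inverse> c = (a \<triangleleft>\<inverse> c) \<triangleleft>\<inverse> (b \<triangleleft>\<inverse> c)"

definition subquandle :: "'a set \<Rightarrow> ('a, 'b) quandle_scheme \<Rightarrow> bool" where
  "subquandle B A \<longleftrightarrow> B \<subseteq> carrier A \<and>
     (\<forall>a\<in>B. \<forall>b\<in>B. a \<triangleleft>\<^bsub>A\<^esub> b \<in> B \<and> a \<triangleleft>\<inverse>\<^bsub>A\<^esub> b \<in> B)"

definition prod_quandle ::
  "('a, 'b) quandle_scheme \<Rightarrow> ('c, 'd) quandle_scheme \<Rightarrow> ('a \<times> 'c) quandle" where
  "prod_quandle A B =
     \<lparr>carrier = carrier A \<times> carrier B,
      rtri = (\<lambda>p q. (fst p \<triangleleft>\<^bsub>A\<^esub> fst q, snd p \<triangleleft>\<^bsub>B\<^esub> snd q)),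
      rtri_inv = (\<lambda>p q. (fst p \<triangleleft>\<inverse>\<^bsub>A\<^esub> fst q, snd p \<triangleleft>\<inverse>\<^bsub>B\<^esub> snd q))\<rparr>"

definition quandle_congruence :: "('a, 'b) quandle_scheme \<Rightarrow> ('a \<times> 'a) set \<Rightarrow> bool" where
  "quandle_congruence A R \<longleftrightarrow> equiv (carrier A) R \<and> subquandle R (prod_quandle A A)"

text \<open>Automorphisms are extensional, i.e. \<open>undefined\<close> outside the carrier, as in
  \<^const>\<open>BijGroup\<close>, whose product \<open>g \<otimes> f\<close> is \<open>g\<close> after \<open>f\<close>.\<close>

definition quandle_auto :: "('a, 'b) quandle_scheme \<Rightarrow> ('a \<Rightarrow> 'a) set" where
  "quandle_auto A = {f \<in> Bij (carrier A). \<forall>a\<in>carrier A. \<forall>b\<in>carrier A.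
     f (a \<triangleleft>\<^bsub>A\<^esub> b) = f a \<triangleleft>\<^bsub>A\<^esub> f b \<and> f (a \<triangleleft>\<inverse>\<^bsub>A\<^esub> b) = f a \<triangleleft>\<inverse>\<^bsub>A\<^esub> f b}"

definition QAut :: "('a, 'b) quandle_scheme \<Rightarrow> ('a \<Rightarrow> 'a) monoid" where
  "QAut A = BijGroup (carrier A) \<lparr>carrier := quandle_auto A\<rparr>"

definition right_transl :: "('a, 'b) quandle_scheme \<Rightarrow> 'a \<Rightarrow> 'a \<Rightarrow> 'a" where
  "right_transl A b = (\<lambda>a\<in>carrier A. a \<triangleleft>\<^bsub>A\<^esub> b)"

definition Inn :: "('a, 'b) quandle_scheme \<Rightarrow> ('a \<Rightarrow> 'a) monoid" where
  "Inn A = QAut A \<lparr>carrier := generate (QAut A) (right_transl A ` carrier A)\<rparr>"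

definition orbit_rel :: "('a, 'b) quandle_scheme \<Rightarrow> ('a \<Rightarrow> 'a) set \<Rightarrow> ('a \<times> 'a) set" where
  "orbit_rel A N = {(a, b). \<exists>U \<in> orbits (Inn A \<lparr>carrier := N\<rparr>) (carrier A) (\<lambda>g. g).
     a \<in> U \<and> b \<in> U}"

text \<open>Composition in the order of maps, the reverse of \<^const>\<open>relcomp\<close>.\<close>

abbreviation rel_after :: "('b \<times> 'c) set \<Rightarrow> ('a \<times> 'b) set \<Rightarrow> ('a \<times> 'c) set"
    (infixr \<open>\<circ>\<^sub>r\<close> 75) where
  "S \<circ>\<^sub>r R \<equiv> R O S"


subsection \<open>Well-definedness of the automorphism groups\<close>

lemma quandle_autoD:
  assumes "f \<in> quandle_auto A"
  shows "f \<in> Bij (carrier A)" "a \<in> carrier A \<Longrightarrow> f a \<in> carrier A"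
    "\<lbrakk>a \<in> carrier A; b \<in> carrier A\<rbrakk> \<Longrightarrow> f (a \<triangleleft>\<^bsub>A\<^esub> b) = f a \<triangleleft>\<^bsub>A\<^esub> f b"
    "\<lbrakk>a \<in> carrier A; b \<in> carrier A\<rbrakk> \<Longrightarrow> f (a \<triangleleft>\<inverse>\<^bsub>A\<^esub> b) = f a \<triangleleft>\<inverse>\<^bsub>A\<^esub> f b"
  using assms Bij_imp_funcset[of f "carrier A"] by (auto simp: quandle_auto_def)

lemma (in quandle) subgroup_quandle_auto:
  "subgroup (quandle_auto A) (BijGroup (carrier A))"
proof (rule subgroup.intro)
  show "quandle_auto A \<subseteq> carrier (BijGroup (carrier A))"
    by (auto simp: quandle_auto_def BijGroup_def)
  show "\<one>\<^bsub>BijGroup (carrier A)\<^esub> \<in> quandle_auto A"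
    by (auto simp: quandle_auto_def BijGroup_def id_Bij rtri_closed rtri_inv_closed)
next
  fix f g assume f: "f \<in> quandle_auto A" and g: "g \<in> quandle_auto A"
  have "f \<otimes>\<^bsub>BijGroup (carrier A)\<^esub> g = compose (carrier A) f g"
    using f g by (simp add: BijGroup_def quandle_autoD(1))
  moreover have "compose (carrier A) f g \<in> quandle_auto A"
    using compose_Bij[OF quandle_autoD(1)[OF f] quandle_autoD(1)[OF g]]
    by (simp add: quandle_auto_def compose_eq rtri_closed rtri_inv_closed
        quandle_autoD(2-4)[OF f] quandle_autoD(2-4)[OF g])
  ultimately show "f \<otimes>\<^bsub>BijGroup (carrier A)\<^esub> g \<in> quandle_auto A" by simp
next
  fix f assume f: "f \<in> quandle_auto A"
  note fB = quandle_autoD(1)[OF f]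
  have "inv_into (carrier A) f (a \<triangleleft> b) = inv_into (carrier A) f a \<triangleleft> inv_into (carrier A) f b"
    if "a \<in> carrier A" "b \<in> carrier A" for a b
    by (rule Bij_inv_into_lemma[where g = "rtri A"])
      (use that fB in \<open>simp_all add: quandle_autoD(3)[OF f] rtri_closed\<close>)
  moreover have "inv_into (carrier A) f (a \<triangleleft>\<inverse> b)
      = inv_into (carrier A) f a \<triangleleft>\<inverse> inv_into (carrier A) f b"
    if "a \<in> carrier A" "b \<in> carrier A" for a b
    by (rule Bij_inv_into_lemma[where g = "rtri_inv A"])
      (use that fB in \<open>simp_all add: quandle_autoD(4)[OF f] rtri_inv_closed\<close>)
  ultimately show "inv\<^bsub>BijGroup (carrier A)\<^esub> f \<in> quandle_auto A"
    using fB restrict_inv_into_Bij[OF fB]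
    by (simp add: inv_BijGroup quandle_auto_def rtri_closed rtri_inv_closed)
qed

lemma (in quandle) group_QAut: "group (QAut A)"
  unfolding QAut_def
  by (rule subgroup.subgroup_is_group[OF subgroup_quandle_auto group_BijGroup])

lemma (in quandle) right_transl_rtri_inv:
  assumes "a \<in> carrier A" "b \<in> carrier A" "c \<in> carrier A"
  shows "(a \<triangleleft>\<inverse> b) \<triangleleft> c = (a \<triangleleft> c) \<triangleleft>\<inverse> (b \<triangleleft> c)"
proof -
  let ?x = "a \<triangleleft>\<inverse> b"
  have x: "?x \<in> carrier A" "?x \<triangleleft> c \<in> carrier A" "b \<triangleleft> c \<in> carrier A"
    using assms by (simp_all add: rtri_closed rtri_inv_closed)
  have "(?x \<triangleleft> c) \<triangleleft> (b \<triangleleft> c) = (?x \<triangleleft> b) \<triangleleft> c"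
    by (rule rtri_distrib[symmetric]) (use assms x in simp_all)
  also have "\<dots> = a \<triangleleft> c" using assms by (simp add: rtri_inv_cancel)
  finally show ?thesis using rtri_cancel[OF x(2,3)] by simp
qed

lemma (in quandle) right_transl_auto:
  assumes b: "b \<in> carrier A"
  shows "right_transl A b \<in> carrier (QAut A)"
proof -
  have "bij_betw (right_transl A b) (carrier A) (carrier A)"
    by (rule bij_betwI[where g = "\<lambda>a. a \<triangleleft>\<inverse> b"])
      (use b in \<open>auto simp: right_transl_def rtri_closed rtri_inv_closed rtri_cancel rtri_inv_cancel\<close>)
  then have "right_transl A b \<in> Bij (carrier A)"
    by (simp add: Bij_def right_transl_def)
  moreover have "right_transl A b (x \<triangleleft> y) = right_transl A b x \<triangleleft> right_transl A b y"
    "right_transl A b (x \<triangleleft>\<inverse> y) = right_transl A b x \<triangleleft>\<inverse> right_transl A b y"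
    if "x \<in> carrier A" "y \<in> carrier A" for x y
    using that rtri_distrib[OF that b] right_transl_rtri_inv[OF that b]
    by (simp_all add: right_transl_def rtri_closed rtri_inv_closed)
  ultimately show ?thesis by (simp add: QAut_def quandle_auto_def)
qed

lemma (in quandle) subgroup_Inn: "subgroup (carrier (Inn A)) (QAut A)"
proof -
  have "right_transl A ` carrier A \<subseteq> carrier (QAut A)"
    using right_transl_auto by blast
  from group.generate_is_subgroup[OF group_QAut this] show ?thesis
    by (simp add: Inn_def)
qed

lemma (in quandle) group_Inn: "group (Inn A)"
  using subgroup.subgroup_is_group[OF subgroup_Inn group_QAut] by (simp add: Inn_def)

end

theory Submission
  imports Defs
begin

text \<open>Inner automorphisms preserve every congruence (\<open>Inn_preserves_congruence\<close>).
  So if \<open>a\<close> is \<open>R\<close>-related to \<open>b\<close> and \<open>g\<close> lies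
  in \<open>N\<close>, the path from \<open>a\<close> via \<open>b\<close> to \<open>g b\<close> can
  be replaced by the path from \<open>a\<close> via \<open>g a\<close> to \<open>g b\<close>: the
  orbit step is taken first and the \<open>R\<close> step is moved along by \<open>g\<close>. This
  gives one inclusion; since both relations are symmetric, the other is its converse.
  \<open>orbit_rel_iff\<close> supplies the element \<open>g\<close>.\<close>

lemma quandle_congruenceD:
  assumes "quandle_congruence A R"
  shows "equiv (carrier A) R"
    "\<lbrakk>(a, b) \<in> R; (c, d) \<in> R\<rbrakk> \<Longrightarrow> (a \<triangleleft>\<^bsub>A\<^esub> c, b \<triangleleft>\<^bsub>A\<^esub> d) \<in> R"
    "\<lbrakk>(a, b) \<in> R; (c, d) \<in> R\<rbrakk> \<Longrightarrow> (a \<triangleleft>\<inverse>\<^bsub>A\<^esub> c, b \<triangleleft>\<inverse>\<^bsub>A\<^esub> d) \<in> R"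
  using assms by (force simp: quandle_congruence_def subquandle_def prod_quandle_def)+

context quandle
begin

lemma QAut_one: "\<one>\<^bsub>QAut A\<^esub> = (\<lambda>a\<in>carrier A. a)"
  by (simp add: QAut_def BijGroup_def)

lemma QAut_mult:
  assumes "f \<in> carrier (QAut A)" "g \<in> carrier (QAut A)"
  shows "f \<otimes>\<^bsub>QAut A\<^esub> g = compose (carrier A) f g"
  using assms by (simp add: QAut_def BijGroup_def quandle_autoD(1))

lemma QAut_closed: "\<lbrakk>f \<in> carrier (QAut A); a \<in> carrier A\<rbrakk> \<Longrightarrow> f a \<in> carrier A"
  by (simp add: QAut_def quandle_autoD(2))

text \<open>A generated subgroup also contains the inverses of its generators. This identifies them
  with the second quandle operation, under which a congruence is closed as well.\<close>

lemma inv_right_transl: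
  assumes b: "b \<in> carrier A" and a: "a \<in> carrier A"
  shows "(inv\<^bsub>QAut A\<^esub> right_transl A b) a = a \<triangleleft>\<inverse> b"
proof -
  interpret Q: group "QAut A" by (rule group_QAut)
  let ?r = "right_transl A b"
  let ?s = "inv\<^bsub>QAut A\<^esub> ?r"
  note r = right_transl_auto[OF b]
  note s = Q.inv_closed[OF r]
  have sa: "?s a \<in> carrier A"
    using s a by (rule QAut_closed)
  have "compose (carrier A) ?r ?s = (\<lambda>a\<in>carrier A. a)"
    using Q.r_inv[OF r] QAut_mult[OF r s] QAut_one by simp
  \<comment> \<open>The inverse is known only through the group law, so its value is found as the
    preimage of \<open>a\<close> under right translation by \<open>b\<close>.\<close>
  then have "?r (?s a) = a"
    using a by (metis compose_eq restrict_apply')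
  then have "?s a \<triangleleft> b = a"
    using sa by (simp add: right_transl_def)
  then show ?thesis
    using rtri_cancel[OF sa b] by simp
qed

text \<open>Induction on the generation of \<open>f\<close>. A generator or its inverse acts by an
  operation with a fixed \<open>c\<close>; compatibility of \<open>R\<close> is applied to the given
  pair and the reflexive pair \<open>(c, c)\<close>.\<close>

lemma Inn_preserves_congruence:
  assumes R: "quandle_congruence A R" and f: "f \<in> carrier (Inn A)" and ab: "(a, b) \<in> R"
  shows "(f a, f b) \<in> R"
proof -
  have sub: "R \<subseteq> carrier A \<times> carrier A" and refl: "\<And>x. x \<in> carrier A \<Longrightarrow> (x, x) \<in> R"
    using quandle_congruenceD(1)[OF R] by (auto simp: equiv_def refl_on_def)
  have "f \<in> generate (QAut A) (right_transl A ` carrier A)"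
    using f by (simp add: Inn_def)
  then show ?thesis
    using ab
  proof (induction arbitrary: a b rule: generate.induct)
    case one
    then show ?case using sub by (auto simp: QAut_one)
  next
    case (incl h)
    then show ?case
      using sub quandle_congruenceD(2)[OF R] refl by (auto simp: right_transl_def)
  next
    case (inv h)
    then show ?case
      using sub quandle_congruenceD(3)[OF R] refl by (auto simp: inv_right_transl)
  next
    case (eng h1 h2)
    have "h1 \<in> carrier (QAut A)" "h2 \<in> carrier (QAut A)"
      using eng.hyps subgroup.subset[OF subgroup_Inn] by (auto simp: Inn_def)
    moreover have "a \<in> carrier A" "b \<in> carrier A"
      using eng.prems sub by auto
    ultimately show ?case
      using eng.IH eng.prems by (simp add: QAut_mult compose_eq)
  qed
qed

text \<open>The product of \<open>Inn A\<close> is inherited from \<open>BijGroup\<close>, so the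
  inclusion of \<open>N\<close> is a homomorphism. This opens the library facts on orbits.\<close>

lemma Inn_subgroup_action:
  assumes N: "subgroup N (Inn A)"
  shows "group_action (Inn A \<lparr>carrier := N\<rparr>) (carrier A) (\<lambda>g. g)"
proof -
  have "N \<subseteq> quandle_auto A"
    using subgroup.subset[OF N] subgroup.subset[OF subgroup_Inn] by (auto simp: QAut_def)
  then have "(\<lambda>g. g) \<in> hom (Inn A \<lparr>carrier := N\<rparr>) (BijGroup (carrier A))"
    by (auto simp: hom_def Inn_def QAut_def BijGroup_def quandle_autoD(1))
  then show ?thesis
    using subgroup.subgroup_is_group[OF N group_Inn] group_BijGroup
    by (simp add: group_action_def group_hom_def group_hom_axioms_def)
qed

text \<open>Turns membership in a common orbit into a single element of \<open>N\<close> carrying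
  one point to the other.\<close>

lemma orbit_rel_iff:
  assumes N: "subgroup N (Inn A)"
  shows "(a, b) \<in> orbit_rel A N \<longleftrightarrow> a \<in> carrier A \<and> (\<exists>g\<in>N. b = g a)"
proof -
  interpret act: group_action "Inn A \<lparr>carrier := N\<rparr>" "carrier A" "\<lambda>g. g"
    by (rule Inn_subgroup_action[OF N])
  show ?thesis
  proof
    assume "(a, b) \<in> orbit_rel A N"
    then obtain x where x: "x \<in> carrier A"
      and a: "a \<in> orbit (Inn A \<lparr>carrier := N\<rparr>) (\<lambda>g. g) x"
      and b: "b \<in> orbit (Inn A \<lparr>carrier := N\<rparr>) (\<lambda>g. g) x"
      by (auto simp: orbit_rel_def orbits_def)
    have aA: "a \<in> carrier A" and bA: "b \<in> carrier A"
      using a b x act.element_image by (auto simp: orbit_def)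
    \<comment> \<open>The base point of the orbit is moved from \<open>x\<close> to
      \<open>a\<close>.\<close>
    have "b \<in> orbit (Inn A \<lparr>carrier := N\<rparr>) (\<lambda>g. g) a"
      using act.orbit_trans[OF aA x bA act.orbit_sym[OF x aA a] b] .
    then show "a \<in> carrier A \<and> (\<exists>g\<in>N. b = g a)"
      using aA by (auto simp: orbit_def)
  next
    assume "a \<in> carrier A \<and> (\<exists>g\<in>N. b = g a)"
    then have aA: "a \<in> carrier A" and b: "b \<in> orbit (Inn A \<lparr>carrier := N\<rparr>) (\<lambda>g. g) a"
      by (auto simp: orbit_def)
    then show "(a, b) \<in> orbit_rel A N"
      using act.orbit_refl[OF aA] by (auto simp: orbit_rel_def orbits_def)
  qed
qed

end

text \<open>Every inner automorphism preserves \<open>R\<close>, so an element of \<open>N\<close> relating one end of a step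
  of \<open>R\<close> to a third point can be applied to the whole step.\<close>

theorem lemma1p3:
  fixes A :: "('a, 'b) quandle_scheme"
    and R :: "('a \<times> 'a) set"
    and N :: "('a \<Rightarrow> 'a) set"
  assumes "quandle A"
    and "quandle_congruence A R"
    and "N \<lhd> Inn A"
  shows "orbit_rel A N \<circ>\<^sub>r R = R \<circ>\<^sub>r orbit_rel A N"
proof -
  interpret quandle A by fact
  have N: "subgroup N (Inn A)"
    using assms(3) by (rule normal_imp_subgroup)
  have sub: "R \<subseteq> carrier A \<times> carrier A" and sym: "sym R"
    using quandle_congruenceD(1)[OF assms(2)] by (auto simp: equiv_def refl_on_def)
  have le: "R O orbit_rel A N \<subseteq> orbit_rel A N O R"
  proof
    fix p assume "p \<in> R O orbit_rel A N"
    then obtain a b g where p: "p = (a, g b)" and ab: "(a, b) \<in> R" and g: "g \<in> N"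
      by (auto simp: orbit_rel_iff[OF N])
    \<comment> \<open>The new middle point is \<open>g a\<close>.\<close>
    have "(a, g a) \<in> orbit_rel A N"
      using ab g sub by (auto simp: orbit_rel_iff[OF N])
    moreover have "(g a, g b) \<in> R"
      using Inn_preserves_congruence[OF assms(2) _ ab] g subgroup.subset[OF N] by blast
    ultimately show "p \<in> orbit_rel A N O R"
      using p by blast
  qed
  have "sym (orbit_rel A N)"
    by (auto simp: sym_def orbit_rel_def)
  \<comment> \<open>Taking converses reverses the order of composition and fixes each symmetric
    factor.\<close>
  then have "orbit_rel A N O R \<subseteq> R O orbit_rel A N"
    using converse_mono[THEN iffD2, OF le] sym
    by (simp add: converse_relcomp sym_conv_converse_eq)
  with le show ?thesis by blast
qed

end
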